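(* Let $h\in\Sigma_A^\alpha[1]$ with $$\mu:=\angle\lim_{z\to1}(1-z)^{1+\alpha}h'(z),$$ and let $F_t(z)=h^{-1}(h(z)+t)$, $z\in\Delta$, $t\ge0$. The following two assertions hold. (A) $\alpha\in[0,2]$. (B) Assume that for some $z\in\Delta$, the trajectory $\{F_t(z)\}_{t\ge0}$ converges to $z=1$ nontangentially. Then: (i) $|\arg\mu|\le\dfrac{\pi}{2}\min\{\alpha,2-\alpha\}$; moreover, if $\alpha\in(0,1]$, then this inequality is strict; (ii) if $\alpha>0$, then $\lim_{t\to\infty}t(1-F_t(z))^\alpha=\dfrac{\mu}{\alpha}$ for all $z\in\Delta$; (iii) if $\alpha>0$, then $\lim_{t\to\infty}\arg(1-F_t(z))=\dfrac1\alpha\arg\mu$ for all $z\in\Delta$.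
   Context: $\Delta$ is the open unit disk in $\mathbb{C}$. $\Sigma[1]$ is the class of univalent holomorphic functions $h:\Delta\to\mathbb{C}$ such that $h(0)=0$, $h(z)+t\in h(\Delta)$ for all $z\in\Delta$, $t\ge0$, and $\lim_{t\to\infty}h^{-1}(h(z)+t)=1$ for all $z\in\Delta$. For real $\alpha\ge0$, $\Sigma_A^\alpha[1]$ is the class of those $h\in\Sigma[1]$ for which the angular (nontangential) limit $\angle\lim_{z\to1}(1-z)^{1+\alpha}h'(z)$ exists, is finite and is different from zero. Powers of $1-z$ and $\arg$ are taken with principal values. The trajectory $\{F_t(z)\}_{t\ge0}$ converges to $1$ nontangentially if $F_t(z)\to1$ and $\inf_{t\ge0}\frac{1-|F_t(z)|}{|1-F_t(z)|}>0$. *)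

theory Defs
  imports "HOL-Complex_Analysis.Complex_Analysis"
begin

abbreviation unit_disk :: "complex set" ("\<Delta>")
  where "\<Delta> \<equiv> ball 0 1"

(* The angular limit at a boundary point \<sigma> is the limit along every Stolz region with
   vertex \<sigma>; the regions are empty for M \<le> 1, so no lower bound on M is needed. *)

definition stolz_region :: "complex \<Rightarrow> real \<Rightarrow> complex set"
  where "stolz_region \<sigma> M = {z \<in> \<Delta>. cmod (\<sigma> - z) < M * (1 - cmod z)}"

definition has_angular_limit :: "(complex \<Rightarrow> complex) \<Rightarrow> complex \<Rightarrow> complex \<Rightarrow> bool"
  where "has_angular_limit f L \<sigma> \<longleftrightarrow> (\<forall>M. (f \<longlongrightarrow> L) (at \<sigma> within stolz_region \<sigma> M))"

(* For h(z) + t in the image of the disk this is h^{-1}(h(z) + t). *)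
definition flow :: "(complex \<Rightarrow> complex) \<Rightarrow> real \<Rightarrow> complex \<Rightarrow> complex"
  where "flow h t z = inv_into \<Delta> h (h z + of_real t)"

definition Sigma_1 :: "(complex \<Rightarrow> complex) set"
  where "Sigma_1 = {h. h holomorphic_on \<Delta> \<and> inj_on h \<Delta> \<and> h 0 = 0 \<and>
    (\<forall>z\<in>\<Delta>. \<forall>t\<ge>0. h z + of_real t \<in> h ` \<Delta>) \<and>
    (\<forall>z\<in>\<Delta>. ((\<lambda>t. flow h t z) \<longlongrightarrow> 1) at_top)}"

definition Sigma_A :: "real \<Rightarrow> (complex \<Rightarrow> complex) set"
  where "Sigma_A \<alpha> = {h \<in> Sigma_1.
    \<exists>\<mu>. \<mu> \<noteq> 0 \<and> has_angular_limit (\<lambda>z. (1 - z) powr of_real (1 + \<alpha>) * deriv h z) \<mu> 1}"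

definition nontangential_trajectory :: "(complex \<Rightarrow> complex) \<Rightarrow> complex \<Rightarrow> bool"
  where "nontangential_trajectory h z \<longleftrightarrow>
    ((\<lambda>t. flow h t z) \<longlongrightarrow> 1) at_top \<and>
    (INF t\<in>{0..}. (1 - cmod (flow h t z)) / cmod (1 - flow h t z)) > 0"

end

theory Submission
  imports Defs
begin

text \<open>
  Applying Schwarz--Pick to \<open>F\<^sub>t\<close> along one of its own orbits, which tends to 1, gives Wolff's lemma
  at the boundary point 1; differentiating it at \<open>t = 0\<close> yields the Berkson--Porta condition
  \<open>Re ((1 - z)\<^sup>2 * h' z) \<ge> 0\<close>. Along the ray \<open>z = 1 - s e\<^bsup>ix\<^esup>\<close>, where \<open>s \<rightarrow> 0\<close>, it becomes
  \<open>Re (\<mu> e\<^bsup>i(1-\<alpha>)x\<^esup>) \<ge> 0\<close> for all \<open>|x| < \<pi>/2\<close>, that is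
  \<open>|arg \<mu>| + |1 - \<alpha>| \<pi>/2 \<le> \<pi>/2\<close>, which contains (A) and the weak inequality in (i).

  By Schwarz--Pick, one nontangential trajectory makes all of them nontangential. On a
  nontangential trajectory the derivative of \<open>(1 - F\<^sub>t)\<^bsup>-\<alpha>\<^esup>\<close> is
  \<open>\<alpha> / ((1 - F\<^sub>t)\<^bsup>1+\<alpha>\<^esup> h'(F\<^sub>t)) \<rightarrow> \<alpha>/\<mu>\<close>, so \<open>(1 - F\<^sub>t)\<^bsup>-\<alpha>\<^esup> / t \<rightarrow> \<alpha>/\<mu>\<close>, which is (ii).
  Taking arguments gives (iii), and the strict inequality in (i) follows because
  \<open>|arg (1 - F\<^sub>t)|\<close> stays bounded away from \<open>\<pi>/2\<close>.
\<close>

section \<open>Schwarz--Pick estimates in the disk and at the boundary point 1\<close>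

lemma one_minus_cnj_mult_neq_0:
  assumes "cmod w < 1" "cmod z < 1"
  shows "1 - cnj w * z \<noteq> 0"
proof
  assume "1 - cnj w * z = 0"
  then have "cmod w * cmod z = 1"
    by (metis complex_mod_cnj norm_mult norm_one right_minus_eq)
  moreover have "cmod w * cmod z \<le> cmod w"
    using assms by (simp add: mult_left_le)
  ultimately show False
    using assms by simp
qed

lemma norm_one_minus_cnj_mult:
  "(cmod (1 - cnj w * z))\<^sup>2 = (cmod (z - w))\<^sup>2 + (1 - (cmod w)\<^sup>2) * (1 - (cmod z)\<^sup>2)"
  unfolding cmod_power2 by (simp add: power2_eq_square algebra_simps)

lemma one_minus_norm_Moebius_function:
  assumes "cmod w < 1" "cmod z < 1"
  shows "1 - (cmod (Moebius_function 0 w z))\<^sup>2 =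
    (1 - (cmod w)\<^sup>2) * (1 - (cmod z)\<^sup>2) / (cmod (1 - cnj w * z))\<^sup>2"
proof -
  have "(cmod (1 - cnj w * z))\<^sup>2 \<noteq> 0"
    using one_minus_cnj_mult_neq_0[OF assms] by simp
  then show ?thesis
    using norm_one_minus_cnj_mult[of w z]
    by (simp add: Moebius_function_simple norm_divide power_divide field_simps)
qed

lemma norm_power2_less_1: "cmod z < 1 \<Longrightarrow> (cmod z)\<^sup>2 < 1"
  by (simp add: power_less_one_iff)

text \<open>Disk automorphisms taking \<open>a\<close> and \<open>f a\<close> to 0 conjugate
  \<open>f\<close> into a map fixing 0, to which the Schwarz lemma applies. In this form, free of
  denominators, the weights of \<open>a\<close> and \<open>f a\<close> are separate factors, so they
  can be compared as \<open>a\<close> approaches the boundary.\<close>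

lemma Schwarz_Pick:
  assumes hol: "f holomorphic_on \<Delta>" and im: "f ` \<Delta> \<subseteq> \<Delta>"
    and a: "a \<in> \<Delta>" and z: "z \<in> \<Delta>"
  shows "(cmod (1 - cnj (f a) * f z))\<^sup>2 * ((1 - (cmod a)\<^sup>2) * (1 - (cmod z)\<^sup>2)) \<le>
    (cmod (1 - cnj a * z))\<^sup>2 * ((1 - (cmod (f a))\<^sup>2) * (1 - (cmod (f z))\<^sup>2))"
proof -
  let ?M = "Moebius_function 0"
  define g where "g = ?M (f a) \<circ> f \<circ> ?M (- a)"
  have M: "cmod (?M w x) < 1" if "cmod w < 1" "cmod x < 1" for w x
    using Moebius_function_norm_lt_1 that by blast
  have a1: "cmod a < 1" "cmod (- a) < 1" and z1: "cmod z < 1"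
    and f1: "\<And>x. cmod x < 1 \<Longrightarrow> cmod (f x) < 1"
    using a z im by (auto simp: image_subset_iff)
  have g_hol: "g holomorphic_on \<Delta>"
    unfolding g_def
  proof (rule holomorphic_on_compose_gen[OF _ holomorphic_on_compose_gen[OF _ _ im]])
    show "?M (- a) holomorphic_on \<Delta>" "?M (f a) holomorphic_on \<Delta>"
      using a1 f1 Moebius_function_holomorphic by blast+
  qed (use hol M a1 in auto)
  have "cmod (g (?M a z)) \<le> cmod (?M a z)"
  proof (rule Schwarz_Lemma(1)[OF g_hol])
    show "g 0 = 0"
      by (simp add: g_def Moebius_function_of_zero Moebius_function_eq_zero)
    show "cmod (g x) < 1" if "cmod x < 1" for x
      unfolding g_def using that M f1 a1 by simp
  qed (use M a1 z1 in auto)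
  moreover have "g (?M a z) = ?M (f a) (f z)"
    unfolding g_def using Moebius_function_compose[of "- a" a z] a1 z1 by simp
  ultimately have "1 - (cmod (?M a z))\<^sup>2 \<le> 1 - (cmod (?M (f a) (f z)))\<^sup>2"
    by (simp add: power_mono)
  then have "(1 - (cmod a)\<^sup>2) * (1 - (cmod z)\<^sup>2) / (cmod (1 - cnj a * z))\<^sup>2
     \<le> (1 - (cmod (f a))\<^sup>2) * (1 - (cmod (f z))\<^sup>2) / (cmod (1 - cnj (f a) * f z))\<^sup>2"
    using one_minus_norm_Moebius_function a1 z1 f1 by simp
  moreover have "(cmod (1 - cnj a * z))\<^sup>2 > 0" "(cmod (1 - cnj (f a) * f z))\<^sup>2 > 0"
    using one_minus_cnj_mult_neq_0 a1 z1 f1 by simp_all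
  ultimately show ?thesis
    by (simp add: field_simps)
qed

text \<open>Each Schwarz--Pick inequality for the pair \<open>(z, a n)\<close> carries the factor
  \<open>(1 - |a (n + 1)|\<^sup>2) / (1 - |a n|\<^sup>2)\<close>, which is at most 1 infinitely often
  because the orbit \<open>a\<close> tends to the boundary.\<close>
lemma Wolff_lemma:
  assumes hol: "f holomorphic_on \<Delta>" and im: "f ` \<Delta> \<subseteq> \<Delta>"
    and a: "\<And>n. a n \<in> \<Delta>" "\<And>n. a (Suc n) = f (a n)" "a \<longlonglongrightarrow> 1"
    and z: "z \<in> \<Delta>"
  shows "(1 - (cmod z)\<^sup>2) / (cmod (1 - z))\<^sup>2 \<le> (1 - (cmod (f z))\<^sup>2) / (cmod (1 - f z))\<^sup>2"
proof -
  define d where "d n = 1 - (cmod (a n))\<^sup>2" for n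
  have d_pos: "d n > 0" for n
    using a(1)[of n] by (simp add: d_def norm_power2_less_1)
  have "d \<longlonglongrightarrow> 1 - (cmod 1)\<^sup>2"
    unfolding d_def by (intro tendsto_intros a)
  then have d_lim: "d \<longlonglongrightarrow> 0"
    by simp
  have freq: "\<exists>\<^sub>F n in sequentially. d (Suc n) \<le> d n"
  proof (rule ccontr)
    assume "\<not> ?thesis"
    then obtain N where N: "\<And>n. n \<ge> N \<Longrightarrow> d n < d (Suc n)"
      by (auto simp: not_frequently eventually_sequentially not_le)
    have "d N \<le> d n" if "n \<ge> N" for n
      using that by (induction n rule: dec_induct) (use N in force)+
    then have "d N \<le> 0"
      by (intro tendsto_lowerbound[OF d_lim]) (auto simp: eventually_sequentially)
    with d_pos[of N] show False by simp
  qed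
  let ?L = "\<lambda>n. (cmod (1 - cnj (a (Suc n)) * f z))\<^sup>2 * (1 - (cmod z)\<^sup>2)"
  let ?R = "\<lambda>n. (cmod (1 - cnj (a n) * z))\<^sup>2 * (1 - (cmod (f z))\<^sup>2)"
  have z1: "cmod z < 1" "cmod (f z) < 1"
    using z im by (auto simp: image_subset_iff)
  have fz_pos: "1 - (cmod (f z))\<^sup>2 > 0"
    using norm_power2_less_1[OF z1(2)] by simp
  have le: "?L n \<le> ?R n" if "d (Suc n) \<le> d n" for n
  proof -
    have "?L n * d n \<le> ?R n * d (Suc n)"
      using Schwarz_Pick[OF hol im a(1)[of n] z] by (simp add: d_def a(2) mult_ac)
    also have "\<dots> \<le> ?R n * d n"
      using that fz_pos by (intro mult_left_mono) auto
    finally show ?thesis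
      using d_pos[of n] by simp
  qed
  have "?L \<longlonglongrightarrow> (cmod (1 - cnj 1 * f z))\<^sup>2 * (1 - (cmod z)\<^sup>2)"
    by (intro tendsto_intros LIMSEQ_Suc a)
  moreover have "?R \<longlonglongrightarrow> (cmod (1 - cnj 1 * z))\<^sup>2 * (1 - (cmod (f z))\<^sup>2)"
    by (intro tendsto_intros a)
  ultimately have lim: "(\<lambda>n. ?R n - ?L n) \<longlonglongrightarrow>
     (cmod (1 - z))\<^sup>2 * (1 - (cmod (f z))\<^sup>2) - (cmod (1 - f z))\<^sup>2 * (1 - (cmod z)\<^sup>2)"
    (is "_ \<longlonglongrightarrow> ?l") by (auto dest: tendsto_diff)
  have "0 \<le> ?l"
  proof (rule ccontr)
    assume "\<not> 0 \<le> ?l"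
    then have "\<forall>\<^sub>F n in sequentially. ?R n - ?L n < 0"
      by (intro order_tendstoD(2)[OF lim]) simp
    moreover have "\<exists>\<^sub>F n in sequentially. 0 \<le> ?R n - ?L n"
      using freq by (rule frequently_elim1) (use le in auto)
    ultimately show False
      unfolding frequently_def by (simp add: not_le)
  qed
  moreover have "(cmod (1 - z))\<^sup>2 > 0" "(cmod (1 - f z))\<^sup>2 > 0"
    using z1 by auto
  ultimately show ?thesis
    by (simp add: field_simps)
qed

text \<open>The hypothesis keeps the pseudo-hyperbolic distance of \<open>a\<close> and
  \<open>b\<close> away from 1. It bounds \<open>|1 - cnj a * b|^2\<close> by
  \<open>4 * K * (1 - |a|) * (1 - |b|)\<close>; since \<open>|1 - cnj a * b|\<close> is at least
  \<open>1 - |a|\<close>, one factor cancels. The second bound follows because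
  \<open>|a - b|\<close> is at most \<open>|1 - cnj a * b|\<close>.\<close>

lemma pseudo_hyperbolic_comparison:
  assumes a: "cmod a < 1" and b: "cmod b < 1" and K: "K > 0"
    and le: "(cmod (1 - cnj a * b))\<^sup>2 \<le> K * ((1 - (cmod a)\<^sup>2) * (1 - (cmod b)\<^sup>2))"
  shows "1 - cmod a \<le> 4 * K * (1 - cmod b)" and "cmod (a - b) \<le> 4 * K * (1 - cmod b)"
proof -
  let ?A = "1 - cmod a" and ?B = "1 - cmod b" and ?D = "cmod (1 - cnj a * b)"
  have A: "1 - (cmod a)\<^sup>2 \<le> 2 * ?A" "1 - (cmod b)\<^sup>2 \<le> 2 * ?B"
    using sum_squares_ge_zero[of "1 - cmod a" 0] sum_squares_ge_zero[of "1 - cmod b" 0]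
    by (auto simp: power2_eq_square algebra_simps)
  have pos: "?A > 0" "?B > 0" "1 - (cmod a)\<^sup>2 > 0" "1 - (cmod b)\<^sup>2 > 0"
    using a b norm_power2_less_1[OF a] norm_power2_less_1[OF b] by auto
  have "(1 - (cmod a)\<^sup>2) * (1 - (cmod b)\<^sup>2) \<le> (2 * ?A) * (2 * ?B)"
    using A pos by (intro mult_mono) auto
  then have "K * ((1 - (cmod a)\<^sup>2) * (1 - (cmod b)\<^sup>2)) \<le> K * ((2 * ?A) * (2 * ?B))"
    using K by (intro mult_left_mono) auto
  with le have "?D\<^sup>2 \<le> K * ((2 * ?A) * (2 * ?B))"
    by (rule order_trans)
  then have D: "?D\<^sup>2 \<le> K * (4 * ?A * ?B)"
    by (simp add: algebra_simps)
  have "cmod (cnj a * b) \<le> cmod a"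
    using b by (simp add: norm_mult mult_left_le)
  moreover have "cmod 1 - cmod (cnj a * b) \<le> ?D"
    by (rule norm_triangle_ineq2)
  ultimately have AD: "?A \<le> ?D"
    by simp
  have "?A * ?A \<le> ?D\<^sup>2"
    using AD pos by (simp add: power2_eq_square mult_mono)
  also note D
  finally have "?A * ?A \<le> (4 * K * ?B) * ?A"
    by (simp add: algebra_simps)
  then show AB: "?A \<le> 4 * K * ?B"
    using pos by simp
  have "?D\<^sup>2 \<le> (4 * K * ?B) * ?A"
    using D by (simp add: algebra_simps)
  also have "\<dots> \<le> (4 * K * ?B) * (4 * K * ?B)"
    using AB pos K by (intro mult_left_mono) auto
  finally have "?D \<le> 4 * K * ?B"
    using pos K by (intro power2_le_imp_le[of ?D]) (auto simp: power2_eq_square)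
  moreover have "(cmod (a - b))\<^sup>2 \<le> ?D\<^sup>2"
    using norm_one_minus_cnj_mult[of a b] pos by (simp add: norm_minus_commute)
  then have "cmod (a - b) \<le> ?D"
    by (rule power2_le_imp_le) simp
  ultimately show "cmod (a - b) \<le> 4 * K * ?B"
    by simp
qed

text \<open>The values \<open>a + b * t\<close> fill an interval centred at \<open>a\<close> with
  half-length \<open>|b| * pi / 2\<close>. If it left \<open>[-pi/2, pi/2]\<close>, it would contain
  a point where the cosine is negative; \<open>|a| <= pi\<close> rules out intervals around other
  multiples of \<open>2 * pi\<close>.\<close>

lemma cos_nonneg_imp_bound:
  fixes a b :: real
  assumes a: "\<bar>a\<bar> \<le> pi" and nonneg: "\<And>t. \<bar>t\<bar> < pi / 2 \<Longrightarrow> cos (a + b * t) \<ge> 0"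
  shows "\<bar>a\<bar> + \<bar>b\<bar> * (pi / 2) \<le> pi / 2"
proof (rule ccontr)
  assume neg: "\<not> ?thesis"
  have c0: "cos \<bar>a\<bar> \<ge> 0"
    using nonneg[of 0] by simp
  have a2: "\<bar>a\<bar> \<le> pi / 2"
  proof (rule ccontr)
    assume "\<not> ?thesis"
    then have "cos \<bar>a\<bar> < cos (pi / 2)"
      using a by (intro cos_monotone_0_pi) auto
    with c0 show False by simp
  qed
  have b: "b \<noteq> 0"
    using neg a2 by auto
  \<comment> \<open>The midpoint between \<open>pi / 2\<close> and the end of the interval, the
    latter capped at \<open>pi\<close> so that \<open>x\<close> stays where the cosine is
    decreasing.\<close>
  define x where "x = (pi / 2 + min (\<bar>a\<bar> + \<bar>b\<bar> * (pi / 2)) pi) / 2"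
  have x: "pi / 2 < x" "x \<le> pi" "x < \<bar>a\<bar> + \<bar>b\<bar> * (pi / 2)"
    using neg pi_gt_zero by (auto simp: x_def min_def field_simps)
  define t where "t = (x - \<bar>a\<bar>) / \<bar>b\<bar>"
  have t: "0 \<le> t" "t < pi / 2" "x = \<bar>a\<bar> + \<bar>b\<bar> * t"
    using x a2 b by (auto simp: t_def field_simps)
  have "cos x < cos (pi / 2)"
    using x by (intro cos_monotone_0_pi) auto
  \<comment> \<open>The signs make \<open>a + b * u\<close> equal to \<open>x\<close> or
    \<open>- x\<close>, and the cosine is even.\<close>
  moreover define u where "u = (if a < 0 then - 1 else 1) * sgn b * t"
  have "\<bar>u\<bar> < pi / 2"
    using t b by (auto simp: u_def abs_mult)
  then have "cos (a + b * u) \<ge> 0"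
    by (rule nonneg)
  moreover have "b * (sgn b * t) = \<bar>b\<bar> * t"
    by (auto simp: sgn_if)
  then have "a + b * u = (if a < 0 then - x else x)"
    unfolding t(3) u_def by (auto simp: algebra_simps)
  ultimately show False
    by (auto split: if_splits)
qed

section \<open>The semigroup generated by \<open>h\<close> and its Berkson--Porta condition\<close>

locale Sigma_function =
  fixes h :: "complex \<Rightarrow> complex"
  assumes Sigma: "h \<in> Sigma_1"
begin

lemma holomorphic: "h holomorphic_on \<Delta>" and inj: "inj_on h \<Delta>"
  and translate: "z \<in> \<Delta> \<Longrightarrow> t \<ge> 0 \<Longrightarrow> h z + of_real t \<in> h ` \<Delta>"
  and flow_tendsto: "z \<in> \<Delta> \<Longrightarrow> ((\<lambda>t. flow h t z) \<longlongrightarrow> 1) at_top"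
  using Sigma by (auto simp: Sigma_1_def)

lemma flow_in_disk: "z \<in> \<Delta> \<Longrightarrow> t \<ge> 0 \<Longrightarrow> flow h t z \<in> \<Delta>"
  unfolding flow_def by (intro inv_into_into translate)

lemma h_flow: "z \<in> \<Delta> \<Longrightarrow> t \<ge> 0 \<Longrightarrow> h (flow h t z) = h z + of_real t"
  unfolding flow_def by (intro f_inv_into_f translate)

lemma flow_eqI: "w \<in> \<Delta> \<Longrightarrow> h w = h z + of_real t \<Longrightarrow> flow h t z = w"
  unfolding flow_def by (intro inv_into_f_eq inj)

lemma flow_flow:
  "z \<in> \<Delta> \<Longrightarrow> s \<ge> 0 \<Longrightarrow> t \<ge> 0 \<Longrightarrow> flow h s (flow h t z) = flow h (t + s) z"
  by (intro flow_eqI flow_in_disk) (auto simp: h_flow flow_in_disk)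

lemma flow_0: "z \<in> \<Delta> \<Longrightarrow> flow h 0 z = z"
  by (intro flow_eqI) auto

text \<open>The last clause puts no sign on \<open>t\<close>: the flow is also controlled for
  slightly negative times, as two-sided derivatives at time 0 require.\<close>

lemma inverse_function:
  obtains g where "g holomorphic_on h ` \<Delta>" "\<And>z. z \<in> \<Delta> \<Longrightarrow> deriv h z * deriv g (h z) = 1"
    "\<And>z t. h z + of_real t \<in> h ` \<Delta> \<Longrightarrow> flow h t z = g (h z + of_real t)"
proof -
  obtain g where g: "g holomorphic_on h ` \<Delta>"
    "\<And>z. z \<in> \<Delta> \<Longrightarrow> deriv h z * deriv g (h z) = 1" "\<And>z. z \<in> \<Delta> \<Longrightarrow> g (h z) = z"
    using holomorphic_has_inverse[OF holomorphic open_ball inj] by metis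
  show thesis
  proof (rule that[OF g(1,2)])
    fix z t assume "h z + complex_of_real t \<in> h ` \<Delta>"
    then obtain w where "w \<in> \<Delta>" "h z + of_real t = h w"
      by auto
    then show "flow h t z = g (h z + of_real t)"
      by (simp add: flow_eqI g(3))
  qed auto
qed

lemma deriv_neq_0: "z \<in> \<Delta> \<Longrightarrow> deriv h z \<noteq> 0"
  by (metis inverse_function mult_zero_left zero_neq_one)

lemma flow_holomorphic:
  assumes "t \<ge> 0"
  shows "flow h t holomorphic_on \<Delta>"
proof -
  obtain g where g: "g holomorphic_on h ` \<Delta>"
    "\<And>z t. h z + of_real t \<in> h ` \<Delta> \<Longrightarrow> flow h t z = g (h z + of_real t)"
    by (metis inverse_function)
  have "g \<circ> (\<lambda>z. h z + of_real t) holomorphic_on \<Delta>"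
    using assms translate
    by (intro holomorphic_on_compose_gen[OF _ g(1)] holomorphic_intros holomorphic) auto
  then show ?thesis
    by (rule holomorphic_transform) (use assms translate g(2) in auto)
qed

lemma flow_has_vector_derivative:
  assumes z: "z \<in> \<Delta>" and t: "t \<ge> 0"
  shows "((\<lambda>t. flow h t z) has_vector_derivative 1 / deriv h (flow h t z)) (at t)"
proof -
  obtain g where g: "g holomorphic_on h ` \<Delta>"
    "\<And>z. z \<in> \<Delta> \<Longrightarrow> deriv h z * deriv g (h z) = 1"
    "\<And>z t. h z + of_real t \<in> h ` \<Delta> \<Longrightarrow> flow h t z = g (h z + of_real t)"
    by (metis inverse_function)
  let ?l = "\<lambda>t. h z + complex_of_real t"
  have op: "open (h ` \<Delta>)"
    using open_mapping_thm3[OF holomorphic open_ball inj] .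
  have l: "(?l has_vector_derivative 1) (at t)"
    by (auto intro!: derivative_eq_intros)
  have dg: "(g has_field_derivative deriv g (?l t)) (at (?l t))"
    using holomorphic_derivI[OF g(1) op translate[OF z t]] .
  have "1 * deriv g (?l t) = 1 / deriv h (flow h t z)"
    using g(2)[OF flow_in_disk[OF z t]] h_flow[OF z t] deriv_neq_0[OF flow_in_disk[OF z t]]
    by (simp add: field_simps)
  with field_vector_diff_chain_at[OF l dg]
  have "((g \<circ> ?l) has_vector_derivative 1 / deriv h (flow h t z)) (at t)"
    by simp
  \<comment> \<open>Openness of the image gives a full neighbourhood of \<open>t\<close>, even when
    \<open>t = 0\<close>.\<close>
  moreover have "open (?l -` (h ` \<Delta>))"
    by (intro continuous_open_vimage op continuous_intros)
  ultimately show ?thesis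
    by (rule has_vector_derivative_transform_within_open) (use translate[OF z t] g(3) in auto)
qed

text \<open>For \<open>t > 0\<close> the iterates of \<open>flow h t\<close> at 0 are the flow at
  times \<open>n * t\<close>, an orbit tending to 1, so Wolff's lemma applies. At
  \<open>t = 0\<close> the orbit would stay at 0, but the flow is the identity.\<close>

lemma flow_Wolff:
  assumes z: "z \<in> \<Delta>" and t: "t \<ge> 0"
  shows "(1 - (cmod z)\<^sup>2) / (cmod (1 - z))\<^sup>2 \<le>
    (1 - (cmod (flow h t z))\<^sup>2) / (cmod (1 - flow h t z))\<^sup>2"
proof (cases "t = 0")
  case False
  have 0: "(0::complex) \<in> \<Delta>"
    by simp
  define a where "a n = flow h (real n * t) 0" for n
  have "filterlim (\<lambda>n. real n * t) at_top sequentially"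
    using False t
    by (auto intro: filterlim_at_top_mult_tendsto_pos[OF tendsto_const] filterlim_real_sequentially)
  then have a: "a \<longlonglongrightarrow> 1"
    unfolding a_def by (rule filterlim_compose[OF flow_tendsto[OF 0]])
  show ?thesis
  proof (rule Wolff_lemma[OF flow_holomorphic[OF t] _ _ _ a z])
    show "flow h t ` \<Delta> \<subseteq> \<Delta>"
      using flow_in_disk t by blast
    show "a n \<in> \<Delta>" for n
      unfolding a_def using flow_in_disk[OF 0] t by simp
    show "a (Suc n) = flow h t (a n)" for n
      unfolding a_def using flow_flow[OF 0] t by (simp add: algebra_simps)
  qed
qed (simp add: flow_0[OF z])

text \<open>By \<open>flow_Wolff\<close> the Poisson kernel \<open>Re ((1 + w) / (1 - w))\<close> increases along the flow,
  and its derivative at time 0 is \<open>Re (2 / ((1 - z)\<^sup>2 * deriv h z))\<close>.\<close>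
lemma Re_Berkson_Porta:
  assumes z: "z \<in> \<Delta>"
  shows "Re ((1 - z)\<^sup>2 * deriv h z) \<ge> 0"
proof -
  define P where "P w = (1 + w) / (1 - w)" for w :: complex
  have P: "Re (P w) = (1 - (cmod w)\<^sup>2) / (cmod (1 - w))\<^sup>2" for w
    unfolding P_def Re_divide cmod_power2 by (simp add: power2_eq_square algebra_simps)
  have z1: "z \<noteq> 1"
    using z by auto
  let ?D = "1 / deriv h z * (2 / (1 - z)\<^sup>2)"
  have "((\<lambda>t. flow h t z) has_vector_derivative 1 / deriv h z) (at 0)"
    using flow_has_vector_derivative[OF z order_refl] by (simp add: flow_0[OF z])
  moreover have "(P has_field_derivative 2 / (1 - z)\<^sup>2) (at z)"
    unfolding P_def using z1
    by (auto intro!: derivative_eq_intros simp: power2_eq_square field_simps)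
  then have "(P has_field_derivative 2 / (1 - z)\<^sup>2) (at (flow h 0 z))"
    by (simp add: flow_0[OF z])
  ultimately have "(P \<circ> (\<lambda>t. flow h t z) has_vector_derivative ?D) (at 0)"
    by (rule field_vector_diff_chain_at)
  then have "((\<lambda>t. Re (P (flow h t z))) has_vector_derivative Re ?D) (at 0)"
    unfolding o_def by (rule bounded_linear.has_vector_derivative[OF bounded_linear_Re])
  then have D: "((\<lambda>t. Re (P (flow h t z))) has_real_derivative Re ?D) (at 0)"
    by (simp only: has_real_derivative_iff_has_vector_derivative)
  have "Re ?D \<ge> 0"
  proof (rule ccontr)
    assume "\<not> Re ?D \<ge> 0"
    then obtain d where d: "d > 0" and dec: "\<And>t. t > 0 \<Longrightarrow> t < d \<Longrightarrow>
        Re (P (flow h (0 + t) z)) < Re (P (flow h 0 z))"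
      using has_real_derivative_neg_dec_right[OF D] by auto
    show False
      using dec[of "d / 2"] d flow_Wolff[OF z, of "d / 2"] by (simp add: P flow_0[OF z])
  qed
  also have "?D = 2 * inverse ((1 - z)\<^sup>2 * deriv h z)"
    by (simp add: divide_inverse)
  finally have "Re (inverse ((1 - z)\<^sup>2 * deriv h z)) \<ge> 0"
    by simp
  \<comment> \<open>Inversion preserves the sign of the real part; \<open>inverse 0 = 0\<close> is
    harmless.\<close>
  moreover have "Re x \<ge> 0" if "Re (inverse x) \<ge> 0" for x
    using that by (auto simp: zero_le_divide_iff sum_power2_le_zero_iff)
  ultimately show ?thesis
    by blast
qed

end

section \<open>Principal powers, approach within Stolz regions, and averages\<close>

lemma rcis_powr_of_real:
  assumes "r > 0" "- pi < x" "x \<le> pi"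
  shows "rcis r x powr of_real a = rcis (r powr a) (a * x)"
proof -
  have "Ln (rcis r x) = of_real (ln r) + \<i> * of_real x"
    using assms by (simp add: rcis_def Ln_times_of_real Ln_of_real cis_conv_exp)
  moreover have "rcis r x \<noteq> 0"
    using assms by simp
  ultimately have "rcis r x powr of_real a = exp (of_real (a * ln r)) * exp (\<i> * of_real (a * x))"
    by (simp add: powr_def exp_add[symmetric] algebra_simps)
  then show ?thesis
    using assms by (simp add: rcis_def cis_conv_exp powr_def flip: exp_of_real)
qed

lemma Arg_powr_of_real:
  assumes "z \<noteq> 0" "- pi < a * Arg z" "a * Arg z \<le> pi"
  shows "Arg (z powr of_real a) = a * Arg z"
proof -
  have "z powr of_real a = rcis (cmod z powr a) (a * Arg z)"
    using rcis_powr_of_real[of "cmod z" "Arg z" a] assms mpi_less_Arg[of z] Arg_le_pi[of z]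
    by (simp add: rcis_cmod_Arg)
  then show ?thesis
    using assms by (simp add: Arg_rcis)
qed

lemma has_angular_limit_compose:
  assumes "has_angular_limit f L \<sigma>" "filterlim g (at \<sigma> within stolz_region \<sigma> M) F"
  shows "((\<lambda>x. f (g x)) \<longlongrightarrow> L) F"
proof -
  have "(f \<longlongrightarrow> L) (at \<sigma> within stolz_region \<sigma> M)"
    using assms(1) by (simp add: has_angular_limit_def)
  then show ?thesis
    using assms(2) by (rule filterlim_compose)
qed

text \<open>Doubling the aperture \<open>1 / m\<close> makes the inequality strict, as
  \<open>stolz_region\<close> demands, because \<open>1 - |w|\<close> is positive.\<close>

lemma stolz_regionI:
  assumes w: "w \<in> \<Delta>" and m: "m > 0" and le: "m * cmod (1 - w) \<le> 1 - cmod w"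
  shows "w \<in> stolz_region 1 (2 / m)"
proof -
  have "m * cmod (1 - w) < 2 * (1 - cmod w)"
    using le w by simp
  then show ?thesis
    using w m by (simp add: stolz_region_def field_simps)
qed

lemma filterlim_stolz_region:
  assumes m: "m > 0" and lim: "(f \<longlongrightarrow> 1) F"
    and ev: "\<forall>\<^sub>F x in F. f x \<in> \<Delta> \<and> m * cmod (1 - f x) \<le> 1 - cmod (f x)"
  shows "filterlim f (at 1 within stolz_region 1 (2 / m)) F"
  unfolding filterlim_at
proof (intro conjI lim)
  show "\<forall>\<^sub>F x in F. f x \<in> stolz_region 1 (2 / m) \<and> f x \<noteq> 1"
    using ev by eventually_elim (auto intro: stolz_regionI[OF _ m])
qed

text \<open>For \<open>0 < s < cos x\<close> the squared modulus
  \<open>1 - s * (2 * cos x - s)\<close> of the point is at most \<open>1 - s * cos x\<close>. Hence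
  its distance to the circle is at least \<open>s * cos x / 2\<close>, while its distance to 1 is
  \<open>s\<close>; the ratio is the constant \<open>cos x / 2\<close>.\<close>

lemma filterlim_ray_stolz_region:
  assumes x: "\<bar>x\<bar> < pi / 2"
  shows "filterlim (\<lambda>s. 1 - rcis s x) (at 1 within stolz_region 1 (2 / (cos x / 2))) (at_right 0)"
proof (rule filterlim_stolz_region)
  have c: "cos x > 0"
    using x by (intro cos_gt_zero_pi) auto
  then show "cos x / 2 > 0"
    by simp
  have "((\<lambda>s. 1 - rcis s x) \<longlongrightarrow> 1 - rcis 0 x) (at_right 0)"
    unfolding rcis_def by (intro tendsto_intros)
  then show "((\<lambda>s. 1 - rcis s x) \<longlongrightarrow> 1) (at_right 0)"
    by simp
  have "\<forall>\<^sub>F s in at_right 0. 0 < s \<and> s < cos x"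
    using eventually_at_right_less[of 0] eventually_at_right_field c eventually_conj by blast
  then show "\<forall>\<^sub>F s in at_right 0. 1 - rcis s x \<in> \<Delta> \<and>
      cos x / 2 * cmod (1 - (1 - rcis s x)) \<le> 1 - cmod (1 - rcis s x)"
  proof eventually_elim
    case (elim s)
    let ?n = "cmod (1 - rcis s x)"
    have "?n\<^sup>2 = 1 - 2 * s * cos x + s\<^sup>2 * ((cos x)\<^sup>2 + (sin x)\<^sup>2)"
      unfolding cmod_power2 by (simp add: power2_eq_square algebra_simps del: sin_cos_squared_add3)
    then have "?n\<^sup>2 = 1 - 2 * s * cos x + s\<^sup>2"
      by simp
    then have "?n\<^sup>2 = 1 - s * (2 * cos x - s)"
      by (simp add: power2_eq_square algebra_simps)
    moreover have "s * cos x \<le> s * (2 * cos x - s)"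
      using elim by (intro mult_left_mono) auto
    ultimately have n: "?n\<^sup>2 \<le> 1 - s * cos x"
      by simp
    have "?n \<le> (1 + ?n\<^sup>2) / 2"
      using sum_squares_ge_zero[of "1 - ?n" 0] by (simp add: power2_eq_square algebra_simps)
    with n have le: "s * cos x / 2 \<le> 1 - ?n"
      by simp
    moreover have "s * cos x > 0"
      using elim c by simp
    ultimately show ?case
      using elim by (auto simp: mult_ac simp del: mult_pos_pos zero_less_mult_iff)
  qed
qed

text \<open>L'Hospital's rule with a denominator tending to infinity asks nothing of the growth of
  \<open>f\<close>. Being a real rule, it is applied to \<open>Re\<close> and \<open>Im\<close>
  separately, both instances of the functional \<open>p\<close>.\<close>

lemma vector_derivative_tendsto_imp_average_tendsto:
  fixes f f' :: "real \<Rightarrow> complex"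
  assumes D: "\<forall>\<^sub>F t in at_top. (f has_vector_derivative f' t) (at t)"
    and lim: "(f' \<longlongrightarrow> L) at_top"
  shows "((\<lambda>t. f t / of_real t) \<longlongrightarrow> L) at_top"
proof -
  have *: "((\<lambda>t. p (f t) / t) \<longlongrightarrow> p L) at_top" if p: "bounded_linear p" for p :: "complex \<Rightarrow> real"
  proof (rule lhospital_at_top_at_top[where g' = "\<lambda>_. 1"])
    show "\<forall>\<^sub>F t in at_top. ((\<lambda>t. p (f t)) has_real_derivative p (f' t)) (at t)"
      using D
    proof eventually_elim
      case (elim t)
      then show ?case
        unfolding has_real_derivative_iff_has_vector_derivative
        by (rule bounded_linear.has_vector_derivative[OF p])
    qed
    show "((\<lambda>t. p (f' t) / 1) \<longlongrightarrow> p L) at_top"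
      using bounded_linear.tendsto[OF p lim] by simp
  qed (auto intro!: always_eventually filterlim_ident)
  show ?thesis
    using *[OF bounded_linear_Re] *[OF bounded_linear_Im]
    by (auto simp: tendsto_complex_iff)
qed

section \<open>The angular limit along rays and along trajectories\<close>

context Sigma_function
begin

text \<open>On the ray \<open>1 - z = rcis s x\<close>, the factor
  \<open>cis ((1 - \<alpha>) * x)\<close> turns the argument of
  \<open>(1 - z) powr (1 + \<alpha>)\<close> into that of \<open>(1 - z)^2\<close>. The product is
  thus a positive multiple of the Berkson--Porta expression, and the sign survives the
  limit.\<close>

lemma Re_angular_limit_nonneg:
  assumes lim: "has_angular_limit (\<lambda>z. (1 - z) powr of_real (1 + \<alpha>) * deriv h z) \<mu> 1"
    and x: "\<bar>x\<bar> < pi / 2"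
  shows "Re (\<mu> * cis ((1 - \<alpha>) * x)) \<ge> 0"
proof -
  define z where "z s = 1 - rcis s x" for s
  have z: "filterlim z (at 1 within stolz_region 1 (2 / (cos x / 2))) (at_right 0)"
    unfolding z_def by (rule filterlim_ray_stolz_region[OF x])
  let ?\<phi> = "\<lambda>z. (1 - z) powr of_real (1 + \<alpha>) * deriv h z"
  have "((\<lambda>s. ?\<phi> (z s)) \<longlongrightarrow> \<mu>) (at_right 0)"
    by (rule has_angular_limit_compose[OF lim z])
  then have "((\<lambda>s. Re (?\<phi> (z s) * cis ((1 - \<alpha>) * x))) \<longlongrightarrow> Re (\<mu> * cis ((1 - \<alpha>) * x))) (at_right 0)"
    by (intro tendsto_intros)
  moreover have "\<forall>\<^sub>F s in at_right 0. 0 < s \<and> z s \<in> \<Delta>"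
    using z eventually_at_right_less[of "0::real"] unfolding filterlim_at
    by (auto elim: eventually_elim2 simp: stolz_region_def)
  then have "\<forall>\<^sub>F s in at_right 0. Re (?\<phi> (z s) * cis ((1 - \<alpha>) * x)) \<ge> 0"
  proof eventually_elim
    case (elim s)
    let ?q = "(1 - z s)\<^sup>2 * deriv h (z s)"
    have "(1 - z s) powr of_real (1 + \<alpha>) = rcis (s powr (1 + \<alpha>)) ((1 + \<alpha>) * x)"
      unfolding z_def using elim x by (subst rcis_powr_of_real[symmetric]) auto
    moreover have "s powr (1 + \<alpha>) = s powr (\<alpha> - 1) * s\<^sup>2"
      using elim by (simp add: powr_add[symmetric] flip: powr_numeral)
    moreover have "(1 - z s)\<^sup>2 = of_real (s\<^sup>2) * cis (2 * x)"
      by (simp add: z_def rcis_def power_mult_distrib Complex.DeMoivre)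
    moreover have "cis ((1 + \<alpha>) * x) * cis ((1 - \<alpha>) * x) = cis (2 * x)"
      by (simp add: cis_mult algebra_simps)
    ultimately have "?\<phi> (z s) * cis ((1 - \<alpha>) * x) = of_real (s powr (\<alpha> - 1)) * ?q"
      by (simp add: rcis_def mult_ac)
    then have "Re (?\<phi> (z s) * cis ((1 - \<alpha>) * x)) = s powr (\<alpha> - 1) * Re ?q"
      by (simp only: times_complex.sel Re_complex_of_real Im_complex_of_real mult_zero_left diff_zero)
    then show ?case
      using Re_Berkson_Porta elim by simp
  qed
  ultimately show ?thesis
    by (rule tendsto_lowerbound) simp
qed

lemma Arg_angular_limit_bound:
  assumes lim: "has_angular_limit (\<lambda>z. (1 - z) powr of_real (1 + \<alpha>) * deriv h z) \<mu> 1"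
    and \<mu>: "\<mu> \<noteq> 0"
  shows "\<bar>Arg \<mu>\<bar> + \<bar>1 - \<alpha>\<bar> * (pi / 2) \<le> pi / 2"
proof (rule cos_nonneg_imp_bound)
  show "\<bar>Arg \<mu>\<bar> \<le> pi"
    using mpi_less_Arg[of \<mu>] Arg_le_pi[of \<mu>] by simp
  show "cos (Arg \<mu> + (1 - \<alpha>) * x) \<ge> 0" if "\<bar>x\<bar> < pi / 2" for x
  proof -
    have "\<mu> * cis ((1 - \<alpha>) * x) = rcis (cmod \<mu>) (Arg \<mu> + (1 - \<alpha>) * x)"
      using rcis_cmod_Arg[of \<mu>] by (metis cis_rcis_eq mult_1_right rcis_mult)
    then have "cmod \<mu> * cos (Arg \<mu> + (1 - \<alpha>) * x) \<ge> 0"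
      using Re_angular_limit_nonneg[OF lim that] by simp
    then show ?thesis
      using \<mu> by (simp add: zero_le_mult_iff)
  qed
qed

lemma nontangential_trajectoryD:
  assumes nt: "nontangential_trajectory h z" and z: "z \<in> \<Delta>"
  shows "\<exists>m>0. \<forall>t\<ge>0. m * cmod (1 - flow h t z) \<le> 1 - cmod (flow h t z)"
proof (intro exI conjI allI impI)
  let ?r = "\<lambda>t. (1 - cmod (flow h t z)) / cmod (1 - flow h t z)"
  have F: "cmod (flow h t z) < 1" if "t \<ge> 0" for t
    using flow_in_disk[OF z that] by simp
  show "(INF t\<in>{0..}. ?r t) > 0"
    using nt by (simp add: nontangential_trajectory_def)
  show "(INF t\<in>{0..}. ?r t) * cmod (1 - flow h t z) \<le> 1 - cmod (flow h t z)" if "0 \<le> t" for t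
  proof -
    have "(INF t\<in>{0..}. ?r t) \<le> ?r t"
      using F that by (intro cINF_lower bdd_belowI2[where m = 0]) (auto simp: less_imp_le)
    moreover have "cmod (1 - flow h t z) > 0"
      using F[OF that] by auto
    ultimately show ?thesis
      by (simp add: pos_le_divide_eq)
  qed
qed

text \<open>By Schwarz--Pick, the pseudo-hyperbolic distance between the two trajectories never
  exceeds that of their starting points, so a single comparison constant serves all times.\<close>

lemma nontangential_all:
  assumes nt: "nontangential_trajectory h z0" and z0: "z0 \<in> \<Delta>" and z: "z \<in> \<Delta>"
  shows "\<exists>m>0. \<forall>t\<ge>0. m * cmod (1 - flow h t z) \<le> 1 - cmod (flow h t z)"
proof -
  obtain m where m: "m > 0"
    and le: "\<And>t. t \<ge> 0 \<Longrightarrow> m * cmod (1 - flow h t z0) \<le> 1 - cmod (flow h t z0)"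
    using nontangential_trajectoryD[OF nt z0] by blast
  have pos: "(1 - (cmod z0)\<^sup>2) * (1 - (cmod z)\<^sup>2) > 0"
    using z0 z by (simp add: norm_power2_less_1)
  \<comment> \<open>This is \<open>1 / (1 - r^2)\<close>, where \<open>r\<close> is the
    pseudo-hyperbolic distance of \<open>z0\<close> and \<open>z\<close>.\<close>
  define K where "K = (cmod (1 - cnj z0 * z))\<^sup>2 / ((1 - (cmod z0)\<^sup>2) * (1 - (cmod z)\<^sup>2))"
  have K: "K > 0"
    unfolding K_def using pos one_minus_cnj_mult_neq_0[of z0 z] z0 z by simp
  \<comment> \<open>The two summands bound \<open>|1 - ?a|\<close> and \<open>|?a - ?b|\<close> in
    the triangle inequality for \<open>|1 - ?b|\<close>.\<close>
  define C where "C = 4 * K / m + 4 * K"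
  have C: "C > 0"
    using K m by (simp add: C_def add_pos_pos)
  show ?thesis
  proof (intro exI[of _ "1 / C"] conjI allI impI)
    show "1 / C > 0"
      using C by simp
    fix t :: real assume t: "0 \<le> t"
    let ?a = "flow h t z0" and ?b = "flow h t z"
    have ab: "cmod ?a < 1" "cmod ?b < 1"
      using flow_in_disk z0 z t by auto
    have "flow h t ` \<Delta> \<subseteq> \<Delta>"
      using flow_in_disk t by blast
    from Schwarz_Pick[OF flow_holomorphic[OF t] this z0 z]
    have "(cmod (1 - cnj ?a * ?b))\<^sup>2 \<le> K * ((1 - (cmod ?a)\<^sup>2) * (1 - (cmod ?b)\<^sup>2))"
      using pos by (simp add: K_def field_simps)
    note cmp = pseudo_hyperbolic_comparison[OF ab K this]
    have "cmod (1 - ?a) \<le> (1 - cmod ?a) / m"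
      using le[OF t] m by (simp add: field_simps)
    also have "\<dots> \<le> 4 * K * (1 - cmod ?b) / m"
      using cmp(1) m by (intro divide_right_mono) auto
    finally have "cmod (1 - ?a) \<le> 4 * K * (1 - cmod ?b) / m" .
    moreover have "cmod (1 - ?b) \<le> cmod (1 - ?a) + cmod (?a - ?b)"
      using norm_triangle_ineq[of "1 - ?a" "?a - ?b"] by simp
    ultimately have "cmod (1 - ?b) \<le> C * (1 - cmod ?b)"
      using cmp(2) by (simp add: C_def algebra_simps)
    then show "1 / C * cmod (1 - ?b) \<le> 1 - cmod ?b"
      using C by (simp add: field_simps)
  qed
qed

lemma flow_rate:
  assumes lim: "has_angular_limit (\<lambda>z. (1 - z) powr of_real (1 + \<alpha>) * deriv h z) \<mu> 1"
    and \<mu>: "\<mu> \<noteq> 0" and \<alpha>: "\<alpha> > 0" and z: "z \<in> \<Delta>" and m: "m > 0"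
    and le: "\<And>t. t \<ge> 0 \<Longrightarrow> m * cmod (1 - flow h t z) \<le> 1 - cmod (flow h t z)"
  shows "((\<lambda>t. of_real t * (1 - flow h t z) powr of_real \<alpha>) \<longlongrightarrow> \<mu> / of_real \<alpha>) at_top"
proof -
  let ?F = "\<lambda>t. flow h t z" and ?\<phi> = "\<lambda>z. (1 - z) powr of_real (1 + \<alpha>) * deriv h z"
  let ?f' = "\<lambda>t. of_real \<alpha> / ?\<phi> (?F t)"
  have ge: "\<forall>\<^sub>F t in at_top. t \<ge> (0::real)"
    by (rule eventually_ge_at_top)
  have "filterlim ?F (at 1 within stolz_region 1 (2 / m)) at_top"
  proof (intro filterlim_stolz_region m flow_tendsto z)
    show "\<forall>\<^sub>F t in at_top. ?F t \<in> \<Delta> \<and> m * cmod (1 - ?F t) \<le> 1 - cmod (?F t)"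
      using ge by eventually_elim (use flow_in_disk[OF z] le in blast)
  qed
  then have "((\<lambda>t. ?\<phi> (?F t)) \<longlongrightarrow> \<mu>) at_top"
    by (rule has_angular_limit_compose[OF lim])
  then have "(?f' \<longlongrightarrow> of_real \<alpha> / \<mu>) at_top"
    by (intro tendsto_intros \<mu>)
  moreover have "((\<lambda>t. (1 - ?F t) powr (- of_real \<alpha>)) has_vector_derivative ?f' t) (at t)"
    if t: "t \<ge> 0" for t
  proof -
    let ?w = "?F t"
    have "Re ?w < 1"
      using flow_in_disk[OF z t] complex_Re_le_cmod[of ?w] by simp
    \<comment> \<open>A positive real part keeps \<open>1 - ?w\<close> off the branch cut of the
      power.\<close>
    then have "1 - ?w \<notin> \<real>\<^sub>\<le>\<^sub>0"
      by (auto simp: complex_nonpos_Reals_iff)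
    note powr = has_field_derivative_powr[OF this, of "- of_real \<alpha>"]
    have "((\<lambda>w. (1 - w) powr (- of_real \<alpha>)) has_field_derivative
        - of_real \<alpha> * (1 - ?w) powr (- of_real \<alpha> - 1) * (- 1)) (at ?w)"
      by (rule DERIV_chain2[where f = "\<lambda>v. v powr (- of_real \<alpha>)" and g = "\<lambda>w. 1 - w", OF powr]) (auto intro!: derivative_eq_intros)
    from field_vector_diff_chain_at[OF flow_has_vector_derivative[OF z t] this]
    have "((\<lambda>t. (1 - ?F t) powr (- of_real \<alpha>)) has_vector_derivative
        1 / deriv h ?w * (of_real \<alpha> * (1 - ?w) powr (- of_real \<alpha> - 1))) (at t)"
      by (simp add: o_def)
    moreover have "- complex_of_real \<alpha> - 1 = - of_real (1 + \<alpha>)"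
      by simp
    then have "(1 - ?w) powr (- of_real \<alpha> - 1) = inverse ((1 - ?w) powr of_real (1 + \<alpha>))"
      by (simp only: powr_minus)
    ultimately show ?thesis
      by (simp add: divide_inverse mult_ac)
  qed
  with ge have "\<forall>\<^sub>F t in at_top. ((\<lambda>t. (1 - ?F t) powr (- of_real \<alpha>)) has_vector_derivative ?f' t) (at t)"
    by (rule eventually_mono)
  ultimately have "((\<lambda>t. (1 - ?F t) powr (- of_real \<alpha>) / of_real t) \<longlongrightarrow> of_real \<alpha> / \<mu>) at_top"
    by (intro vector_derivative_tendsto_imp_average_tendsto)
  then have "((\<lambda>t. inverse ((1 - ?F t) powr (- of_real \<alpha>) / of_real t)) \<longlongrightarrow> inverse (of_real \<alpha> / \<mu>)) at_top"
    using \<mu> \<alpha> by (intro tendsto_inverse) auto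
  then show ?thesis
    by (simp add: powr_minus divide_inverse mult_ac)
qed

text \<open>Since \<open>1 - |w|\<close> is at most
  \<open>Re (1 - w) = |1 - w| * cos (Arg (1 - w))\<close>, the nontangential bound says that this
  cosine is at least \<open>m\<close>.\<close>

lemma Arg_one_minus_flow_bound:
  assumes z: "z \<in> \<Delta>" and t: "t \<ge> 0"
    and le: "m * cmod (1 - flow h t z) \<le> 1 - cmod (flow h t z)" and m: "m > 0"
  shows "\<bar>Arg (1 - flow h t z)\<bar> \<le> arccos m" "m \<le> 1"
proof -
  let ?v = "1 - flow h t z"
  have F: "cmod (flow h t z) < 1"
    using flow_in_disk[OF z t] by simp
  then have v: "cmod ?v > 0"
    by auto
  have "1 - cmod (flow h t z) \<le> Re ?v"
    using complex_Re_le_cmod[of "flow h t z"] by simp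
  also have "Re ?v = cmod ?v * cos (Arg ?v)"
    by (metis rcis_cmod_Arg Re_rcis)
  finally have "m * cmod ?v \<le> cos (Arg ?v) * cmod ?v"
    using le by (simp add: mult.commute)
  with v have c: "m \<le> cos (Arg ?v)"
    by (rule mult_right_le_imp_le[rotated])
  then show m1: "m \<le> 1"
    using cos_le_one order_trans by blast
  have "arccos (cos \<bar>Arg ?v\<bar>) \<le> arccos m"
    using c m by (intro arccos_le_arccos) auto
  moreover have "\<bar>Arg ?v\<bar> \<le> pi"
    using mpi_less_Arg[of ?v] Arg_le_pi[of ?v] by simp
  ultimately show "\<bar>Arg ?v\<bar> \<le> arccos m"
    by (simp only: arccos_cos abs_ge_zero)
qed

lemma Arg_flow_tendsto:
  assumes lim: "has_angular_limit (\<lambda>z. (1 - z) powr of_real (1 + \<alpha>) * deriv h z) \<mu> 1"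
    and \<mu>: "\<mu> \<noteq> 0" and \<alpha>: "\<alpha> > 0" "\<alpha> \<le> 2" and z: "z \<in> \<Delta>" and m: "m > 0"
    and le: "\<And>t. t \<ge> 0 \<Longrightarrow> m * cmod (1 - flow h t z) \<le> 1 - cmod (flow h t z)"
  shows "((\<lambda>t. Arg (1 - flow h t z)) \<longlongrightarrow> Arg \<mu> / \<alpha>) at_top"
    and "\<bar>Arg \<mu>\<bar> < \<alpha> * (pi / 2)"
proof -
  let ?A = "\<lambda>t. Arg (1 - flow h t z)"
  note Arg_le = Arg_one_minus_flow_bound[OF z _ le m]
  have m1: "m \<le> 1"
    using Arg_le(2)[of 0] by simp
  have acos: "arccos m < pi / 2"
    using arccos_less_arccos[of 0 m] m m1 by simp
  have "0 \<le> \<bar>1 - \<alpha>\<bar> * (pi / 2)"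
    by simp
  then have "\<bar>Arg \<mu>\<bar> \<le> pi / 2"
    using Arg_angular_limit_bound[OF lim \<mu>] by linarith
  \<comment> \<open>With \<open>|Arg \<mu>| <= pi / 2\<close> the limit in \<open>flow_rate\<close>
    avoids the cut, so \<open>Arg\<close> is continuous there.\<close>
  then have "\<bar>Arg (\<mu> / of_real \<alpha>)\<bar> < pi"
    using \<alpha> pi_gt_zero by (simp del: pi_gt_zero)
  moreover have "\<mu> / of_real \<alpha> \<noteq> 0"
    using \<mu> \<alpha> by simp
  ultimately have "\<mu> / of_real \<alpha> \<notin> \<real>\<^sub>\<le>\<^sub>0"
    using Arg_eq_pi[of "\<mu> / of_real \<alpha>"]
    unfolding complex_nonpos_Reals_iff complex_eq_iff by force
  then have "((\<lambda>t. Arg (of_real t * (1 - flow h t z) powr of_real \<alpha>)) \<longlongrightarrow> Arg (\<mu> / of_real \<alpha>)) at_top"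
    by (rule isCont_tendsto_compose[OF continuous_at_Arg flow_rate[OF lim \<mu> \<alpha>(1) z m le]])
  moreover have "\<forall>\<^sub>F t in at_top. Arg (of_real t * (1 - flow h t z) powr of_real \<alpha>) = \<alpha> * ?A t"
    using eventually_gt_at_top[of 0]
  proof eventually_elim
    case (elim t)
    \<comment> \<open>Here \<open>\<alpha> <= 2\<close> and \<open>arccos m < pi / 2\<close> keep
      \<open>\<alpha> * ?A t\<close> in the principal range, so that \<open>Arg\<close> of the power
      is exactly this product.\<close>
    have "\<bar>\<alpha> * ?A t\<bar> \<le> 2 * arccos m"
      unfolding abs_mult using \<alpha> Arg_le(1)[of t] elim by (intro mult_mono) auto
    also have "\<dots> < pi"
      using acos by simp
    finally have "\<bar>\<alpha> * ?A t\<bar> < pi" .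
    moreover have "1 - flow h t z \<noteq> 0"
      using flow_in_disk[OF z, of t] elim by auto
    ultimately show ?case
      using elim by (simp add: Arg_powr_of_real abs_less_iff)
  qed
  ultimately have "((\<lambda>t. \<alpha> * ?A t) \<longlongrightarrow> Arg \<mu>) at_top"
    unfolding Arg_divide_of_real[OF \<alpha>(1)] by (rule Lim_transform_eventually)
  then have "((\<lambda>t. \<alpha> * ?A t / \<alpha>) \<longlongrightarrow> Arg \<mu> / \<alpha>) at_top"
    using \<alpha> by (intro tendsto_intros) auto
  then show A: "(?A \<longlongrightarrow> Arg \<mu> / \<alpha>) at_top"
    using \<alpha> by simp
  \<comment> \<open>The uniform bound \<open>arccos m\<close> passes to the limit; lying strictly
    below \<open>pi / 2\<close>, it yields the strict inequality.\<close>
  have "\<bar>Arg \<mu> / \<alpha>\<bar> \<le> arccos m"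
  proof (rule tendsto_upperbound)
    show "((\<lambda>t. \<bar>?A t\<bar>) \<longlongrightarrow> \<bar>Arg \<mu> / \<alpha>\<bar>) at_top"
      by (intro tendsto_intros A)
    show "\<forall>\<^sub>F t in at_top. \<bar>?A t\<bar> \<le> arccos m"
      using eventually_ge_at_top[of 0] by eventually_elim (rule Arg_le(1))
  qed simp
  then have "\<bar>Arg \<mu> / \<alpha>\<bar> < pi / 2"
    using acos by (rule le_less_trans)
  then show "\<bar>Arg \<mu>\<bar> < \<alpha> * (pi / 2)"
    using \<alpha> by (simp add: abs_divide field_simps)
qed

end

text \<open>The radius to 1 already determines the limit. This identifies the given \<mu> with the
  nonzero limit whose existence \<open>Sigma_A\<close> asserts.\<close>

lemma has_angular_limit_unique:
  assumes "has_angular_limit f L 1" "has_angular_limit f L' 1"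
  shows "L = L'"
proof -
  have ray: "filterlim (\<lambda>s. 1 - rcis s 0) (at 1 within stolz_region 1 (2 / (cos 0 / 2))) (at_right 0)"
    by (rule filterlim_ray_stolz_region) simp
  have "((\<lambda>s. f (1 - rcis s 0)) \<longlongrightarrow> K) (at_right 0)" if "has_angular_limit f K 1" for K
    by (rule has_angular_limit_compose[OF that ray])
  then show ?thesis
    using assms tendsto_unique trivial_limit_at_right_real by blast
qed

theorem theorem12:
  fixes \<alpha> :: real and \<mu> :: complex and h :: "complex \<Rightarrow> complex"
  assumes "\<alpha> \<ge> 0"
    and "h \<in> Sigma_A \<alpha>"
    and "has_angular_limit (\<lambda>z. (1 - z) powr of_real (1 + \<alpha>) * deriv h z) \<mu> 1"
  shows "\<alpha> \<in> {0..2} \<and>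
    ((\<exists>z\<in>\<Delta>. nontangential_trajectory h z) \<longrightarrow>
      \<bar>Arg \<mu>\<bar> \<le> pi / 2 * min \<alpha> (2 - \<alpha>) \<and>
      (\<alpha> \<in> {0<..1} \<longrightarrow> \<bar>Arg \<mu>\<bar> < pi / 2 * min \<alpha> (2 - \<alpha>)) \<and>
      (\<alpha> > 0 \<longrightarrow> (\<forall>z\<in>\<Delta>.
        ((\<lambda>t. of_real t * (1 - flow h t z) powr of_real \<alpha>) \<longlongrightarrow> \<mu> / of_real \<alpha>) at_top)) \<and>
      (\<alpha> > 0 \<longrightarrow> (\<forall>z\<in>\<Delta>.
        ((\<lambda>t. Arg (1 - flow h t z)) \<longlongrightarrow> Arg \<mu> / \<alpha>) at_top)))"
proof -
  interpret Sigma_function h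
    using assms(2) by unfold_locales (simp add: Sigma_A_def)
  note lim = assms(3)
  have \<mu>: "\<mu> \<noteq> 0"
    using assms(2) has_angular_limit_unique[OF lim] by (auto simp: Sigma_A_def)
  have bound: "\<bar>Arg \<mu>\<bar> + \<bar>1 - \<alpha>\<bar> * (pi / 2) \<le> pi / 2"
    by (rule Arg_angular_limit_bound[OF lim \<mu>])
  then have "\<bar>1 - \<alpha>\<bar> * (pi / 2) \<le> 1 * (pi / 2)"
    by linarith
  then have "\<bar>1 - \<alpha>\<bar> \<le> 1"
    by (rule mult_right_le_imp_le) simp
  then have \<alpha>: "\<alpha> \<in> {0..2}"
    by auto
  \<comment> \<open>This identity turns \<open>bound\<close> into the weak inequality of
    (i).\<close>
  have "min \<alpha> (2 - \<alpha>) = 1 - \<bar>1 - \<alpha>\<bar>"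
    by auto
  then have Arg: "\<bar>Arg \<mu>\<bar> \<le> pi / 2 * min \<alpha> (2 - \<alpha>)"
    using bound by (simp only:) (simp add: algebra_simps)
  \<comment> \<open>For \<open>\<alpha> <= 1\<close> the minimum is \<alpha>, so strictness is the
    second claim of \<open>Arg_flow_tendsto\<close>.\<close>
  have "(\<alpha> \<le> 1 \<longrightarrow> \<bar>Arg \<mu>\<bar> < pi / 2 * min \<alpha> (2 - \<alpha>)) \<and>
      ((\<lambda>t. of_real t * (1 - flow h t z) powr of_real \<alpha>) \<longlongrightarrow> \<mu> / of_real \<alpha>) at_top \<and>
      ((\<lambda>t. Arg (1 - flow h t z)) \<longlongrightarrow> Arg \<mu> / \<alpha>) at_top"
    if z0: "z0 \<in> \<Delta>" "nontangential_trajectory h z0" and "\<alpha> > 0" "z \<in> \<Delta>" for z0 z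
  proof -
    obtain m where m: "m > 0"
      "\<And>t. t \<ge> 0 \<Longrightarrow> m * cmod (1 - flow h t z) \<le> 1 - cmod (flow h t z)"
      using nontangential_all[OF z0(2,1) \<open>z \<in> \<Delta>\<close>] by blast
    have "\<alpha> \<le> 2"
      using \<alpha> by simp
    note A = Arg_flow_tendsto[OF lim \<mu> \<open>\<alpha> > 0\<close> this \<open>z \<in> \<Delta>\<close> m]
    show ?thesis
      using A flow_rate[OF lim \<mu> \<open>\<alpha> > 0\<close> \<open>z \<in> \<Delta>\<close> m] by (auto simp: mult.commute)
  qed
  then show ?thesis
    using \<alpha> Arg by (meson greaterThanAtMost_iff)
qed

end
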